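(* Let $A>0$, $\alpha>0$, let $B:(0,\infty)\to(0,\infty)$ be a positive function, and let $\Psi\in\mathbb R^2$, $\Psi\ne0$. Suppose the local quadratic covariance $$Q(x,\Psi)=\frac{xB(x)}{2}I_2+\frac{A}{2\alpha x}\Psi\Psi^\top,\qquad x>0,$$ is known (ideal continuous noiseless experiment). Let $\Lambda_\rho$ be its eigenvalue in the radial direction $\Psi$ and $\Lambda_\theta$ its eigenvalue in the direction orthogonal to $\Psi$. Then $$\Lambda_\theta=\frac{xB(x)}{2},\qquad \Lambda_\rho-\Lambda_\theta=\frac{A|\Psi|^2}{2\alpha x},$$ and therefore $$x=\frac{A|\Psi|^2}{2\alpha(\Lambda_\rho-\Lambda_\theta)}.$$ Once $x$ is recovered, the speckle $\gamma$ and the value $B(x)$ are given by $$\gamma=\frac{\Psi}{\sqrt x},\qquad B(x)=\frac{2\Lambda_\theta}{x}.$$ Thus the latent texture $x$ is globally identified on each non-zero observation fibre, independently of the functional form of the positive scale coupling $B$: given $A$, $\alpha$ and $\Psi$, the matrix $Q(x,\Psi)$ determines $x$ without knowledge of $B$.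
   Context: Field's sea-clutter model: a positive texture $x_t$ with $dx_t=A(1-x_t)\,dt+\sqrt{2Ax_t/\alpha}\,dW^x_t$, and a speckle $\gamma_t=(\gamma^R_t,\gamma^I_t)\in\mathbb R^2\cong\mathbb C$ whose two components have diffusion covariance $\frac{B(x)}{2}I_2$, all driving Brownian motions being independent. The observation is $\Psi_t=\sqrt{x_t}\,\gamma_t$, with values in $\mathbb R^2\cong\mathbb C$. The observation fibre over $\Psi\ne0$ is $\{(x,\Psi/\sqrt x):x>0\}$. The matrix $Q(x,\Psi)$ is the quadratic-covariation density of the observed process at the latent point $(x,\Psi/\sqrt x)$. *)

theory Defs
  imports "HOL-Analysis.Analysis"
begin

text \<open>The complex plane is represented by \<open>real^2\<close>. A latent point is a pair of a
  texture value and a speckle value.\<close>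

definition observation :: "real \<times> (real^2) \<Rightarrow> real^2" where
  "observation p = sqrt (fst p) *\<^sub>R snd p"

definition observation_fibre :: "real^2 \<Rightarrow> (real \<times> (real^2)) set" where
  "observation_fibre \<Psi> = {p. fst p > 0 \<and> observation p = \<Psi>}"

text \<open>The local quadratic covariance at the latent point
  \<open>(x, \<gamma>) = (x, \<Psi> / sqrt x)\<close>. By the Ito formula for \<open>\<Psi> = sqrt x \<gamma>\<close>, the speckle noise
  contributes \<open>x (B x / 2) I\<close> and the texture noise contributes
  \<open>(2 A x / \<alpha>) (\<gamma> / (2 sqrt x)) (\<gamma> / (2 sqrt x))\<^sup>T = A / (2 \<alpha> x) \<Psi> \<Psi>\<^sup>T\<close>.
  The type constraints are needed because the row dimension of \<open>rowvector\<close> and the column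
  dimension of \<open>columnvector\<close> are otherwise unconstrained.\<close>

definition local_covariance ::
  "real \<Rightarrow> real \<Rightarrow> (real \<Rightarrow> real) \<Rightarrow> real \<Rightarrow> real^2 \<Rightarrow> real^2^2" where
  "local_covariance A \<alpha> B x \<Psi> =
     (x * B x / 2) *\<^sub>R mat 1
     + (A / (2 * \<alpha> * x)) *\<^sub>R ((columnvector \<Psi> :: real^1^2) ** (rowvector \<Psi> :: real^2^1))"

definition eigenvalue_along :: "real^'n^'n \<Rightarrow> real^'n \<Rightarrow> real \<Rightarrow> bool" where
  "eigenvalue_along M v l \<longleftrightarrow> v \<noteq> 0 \<and> M *v v = l *\<^sub>R v"

end

theory Submission
  imports Defs
begin

text \<open>The covariance is a multiple of the identity plus a rank-one matrix that vanishes on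
  the orthogonal complement of \<open>\<Psi>\<close>. So every non-zero vector orthogonal to \<open>\<Psi>\<close> is an
  eigenvector that sees only the isotropic speckle part, whereas \<open>\<Psi>\<close> itself also picks up
  the texture part. The unknown coupling \<open>B\<close> enters both eigenvalues through the same term
  \<open>x * B x / 2\<close> and cancels in their difference, which is a known positive constant divided
  by \<open>x\<close> and can therefore be inverted for \<open>x\<close>.

  For the global identification, fix one direction orthogonal to \<open>\<Psi>\<close>. Both eigenvalues are
  functions of the matrix alone, so two models with the same matrix share them; the recovery
  formula for \<open>x\<close> does not mention \<open>B\<close>, hence the textures agree, and then so do the
  speckles and the coupling values at that texture.\<close>

lemma mem_observation_fibre_iff:
  "(x, \<gamma>) \<in> observation_fibre \<Psi> \<longleftrightarrow> x > 0 \<and> \<gamma> = (1 / sqrt x) *\<^sub>R \<Psi>"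
  by (auto simp: observation_fibre_def observation_def)

lemma local_covariance_mult_vec:
  "local_covariance A \<alpha> B x \<Psi> *v v
     = (x * B x / 2) *\<^sub>R v + (A / (2 * \<alpha> * x) * (\<Psi> \<bullet> v)) *\<^sub>R \<Psi>"
  by (simp add: local_covariance_def vec_eq_iff matrix_vector_mult_def matrix_matrix_mult_def
      columnvector_def rowvector_def mat_def inner_vec_def sum_2 forall_2 algebra_simps)

lemma eigenvalue_along_iff_of_mult_vec:
  fixes v :: "real^'n"
  assumes "v \<noteq> 0" and "M *v v = l *\<^sub>R v"
  shows "eigenvalue_along M v m \<longleftrightarrow> m = l"
  using assms by (auto simp: eigenvalue_along_def)

lemma radial_eigenvalue_iff:
  assumes "\<Psi> \<noteq> 0"
  shows "eigenvalue_along (local_covariance A \<alpha> B x \<Psi>) \<Psi> l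
     \<longleftrightarrow> l = x * B x / 2 + A * (norm \<Psi>)\<^sup>2 / (2 * \<alpha> * x)"
  using assms
  by (intro eigenvalue_along_iff_of_mult_vec)
     (simp_all add: local_covariance_mult_vec power2_norm_eq_inner scaleR_add_left)

lemma angular_eigenvalue_iff:
  assumes "v \<noteq> 0" and "orthogonal \<Psi> v"
  shows "eigenvalue_along (local_covariance A \<alpha> B x \<Psi>) v l \<longleftrightarrow> l = x * B x / 2"
  using assms
  by (intro eigenvalue_along_iff_of_mult_vec)
     (simp_all add: local_covariance_mult_vec orthogonal_def)

text \<open>The right-hand side is free of \<open>B\<close>: the coupling shifts both eigenvalues equally, so
  the spectral gap depends on the texture alone.\<close>

lemma texture_eq_of_eigenvalues:
  assumes "A > 0" "\<alpha> > 0" "\<Psi> \<noteq> 0" "x > 0" "v \<noteq> 0" "orthogonal \<Psi> v"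
    and "eigenvalue_along (local_covariance A \<alpha> B x \<Psi>) \<Psi> r"
    and "eigenvalue_along (local_covariance A \<alpha> B x \<Psi>) v t"
  shows "x = A * (norm \<Psi>)\<^sup>2 / (2 * \<alpha> * (r - t))"
proof -
  have "r - t = A * (norm \<Psi>)\<^sup>2 / (2 * \<alpha> * x)"
    using assms by (simp add: radial_eigenvalue_iff angular_eigenvalue_iff)
  then show ?thesis
    using assms(1-4) by simp
qed

text \<open>Two models with the same covariance matrix have the same eigenvalues along \<open>\<Psi>\<close> and along a vector orthogonal to it;
  the gap fixes the texture, and the angular eigenvalue then fixes the coupling value.\<close>

lemma local_covariance_identifies:
  assumes "A > 0" "\<alpha> > 0" "\<Psi> \<noteq> 0" "x > 0" "y > 0"
    and eq: "local_covariance A \<alpha> B x \<Psi> = local_covariance A \<alpha> C y \<Psi>"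
  shows "x = y" and "B x = C y"
proof -
  obtain v :: "real^2" where v: "v \<noteq> 0" "orthogonal \<Psi> v"
    using orthogonal_to_vector_exists[of \<Psi>] by auto
  obtain r t where
    r: "eigenvalue_along (local_covariance A \<alpha> B x \<Psi>) \<Psi> r" and
    t: "eigenvalue_along (local_covariance A \<alpha> B x \<Psi>) v t"
    using radial_eigenvalue_iff[OF assms(3)] angular_eigenvalue_iff[OF v] by blast
  note r' = r[unfolded eq] and t' = t[unfolded eq]
  show xy: "x = y"
    using texture_eq_of_eigenvalues[OF assms(1-4) v r t]
      texture_eq_of_eigenvalues[OF assms(1-3,5) v r' t'] by simp
  have "x * B x / 2 = y * C y / 2"
    using t t' angular_eigenvalue_iff[OF v] by simp
  then show "B x = C y"
    using xy \<open>y > 0\<close> by simp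
qed

theorem corollary7p2:
  fixes A \<alpha> :: real and B :: "real \<Rightarrow> real" and \<Psi> :: "real^2"
  assumes "A > 0" and "\<alpha> > 0"
    and "\<forall>x>0. B x > 0"
    and "\<Psi> \<noteq> 0"
  shows
    "observation_fibre \<Psi> = {(x, (1 / sqrt x) *\<^sub>R \<Psi>) | x. x > 0}
     \<and> (\<forall>x>0. \<forall>v. v \<noteq> 0 \<and> orthogonal \<Psi> v \<longrightarrow>
          (\<exists>!\<Lambda>\<^sub>\<rho>. eigenvalue_along (local_covariance A \<alpha> B x \<Psi>) \<Psi> \<Lambda>\<^sub>\<rho>)
          \<and> (\<exists>!\<Lambda>\<^sub>\<theta>. eigenvalue_along (local_covariance A \<alpha> B x \<Psi>) v \<Lambda>\<^sub>\<theta>))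
     \<and> (\<forall>x \<gamma> v \<Lambda>\<^sub>\<rho> \<Lambda>\<^sub>\<theta>.
          (x, \<gamma>) \<in> observation_fibre \<Psi>
          \<and> v \<noteq> 0 \<and> orthogonal \<Psi> v
          \<and> eigenvalue_along (local_covariance A \<alpha> B x \<Psi>) \<Psi> \<Lambda>\<^sub>\<rho>
          \<and> eigenvalue_along (local_covariance A \<alpha> B x \<Psi>) v \<Lambda>\<^sub>\<theta> \<longrightarrow>
            \<Lambda>\<^sub>\<theta> = x * B x / 2
            \<and> \<Lambda>\<^sub>\<rho> - \<Lambda>\<^sub>\<theta> = A * (norm \<Psi>)\<^sup>2 / (2 * \<alpha> * x)
            \<and> x = A * (norm \<Psi>)\<^sup>2 / (2 * \<alpha> * (\<Lambda>\<^sub>\<rho> - \<Lambda>\<^sub>\<theta>))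
            \<and> \<gamma> = (1 / sqrt x) *\<^sub>R \<Psi>
            \<and> B x = 2 * \<Lambda>\<^sub>\<theta> / x)
     \<and> (\<forall>B\<^sub>1 B\<^sub>2 x\<^sub>1 x\<^sub>2 \<gamma>\<^sub>1 \<gamma>\<^sub>2.
          (\<forall>x>0. B\<^sub>1 x > 0) \<and> (\<forall>x>0. B\<^sub>2 x > 0)
          \<and> (x\<^sub>1, \<gamma>\<^sub>1) \<in> observation_fibre \<Psi> \<and> (x\<^sub>2, \<gamma>\<^sub>2) \<in> observation_fibre \<Psi>
          \<and> local_covariance A \<alpha> B\<^sub>1 x\<^sub>1 \<Psi> = local_covariance A \<alpha> B\<^sub>2 x\<^sub>2 \<Psi> \<longrightarrow>
            x\<^sub>1 = x\<^sub>2 \<and> \<gamma>\<^sub>1 = \<gamma>\<^sub>2 \<and> B\<^sub>1 x\<^sub>1 = B\<^sub>2 x\<^sub>2)"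
proof (intro conjI)
  show "observation_fibre \<Psi> = {(x, (1 / sqrt x) *\<^sub>R \<Psi>) | x. x > 0}"
    by (auto simp: mem_observation_fibre_iff)
next
  show "\<forall>x>0. \<forall>v. v \<noteq> 0 \<and> orthogonal \<Psi> v \<longrightarrow>
          (\<exists>!r. eigenvalue_along (local_covariance A \<alpha> B x \<Psi>) \<Psi> r)
          \<and> (\<exists>!t. eigenvalue_along (local_covariance A \<alpha> B x \<Psi>) v t)"
    using radial_eigenvalue_iff[OF assms(4)] angular_eigenvalue_iff by metis
next
  show "\<forall>x \<gamma> v r t.
          (x, \<gamma>) \<in> observation_fibre \<Psi>
          \<and> v \<noteq> 0 \<and> orthogonal \<Psi> v
          \<and> eigenvalue_along (local_covariance A \<alpha> B x \<Psi>) \<Psi> r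
          \<and> eigenvalue_along (local_covariance A \<alpha> B x \<Psi>) v t \<longrightarrow>
            t = x * B x / 2
            \<and> r - t = A * (norm \<Psi>)\<^sup>2 / (2 * \<alpha> * x)
            \<and> x = A * (norm \<Psi>)\<^sup>2 / (2 * \<alpha> * (r - t))
            \<and> \<gamma> = (1 / sqrt x) *\<^sub>R \<Psi>
            \<and> B x = 2 * t / x"
  proof (intro allI impI, elim conjE)
    fix x \<gamma> v r t
    assume fibre: "(x, \<gamma>) \<in> observation_fibre \<Psi>"
      and v: "v \<noteq> 0" "orthogonal \<Psi> v"
      and r: "eigenvalue_along (local_covariance A \<alpha> B x \<Psi>) \<Psi> r"
      and t: "eigenvalue_along (local_covariance A \<alpha> B x \<Psi>) v t"
    have x: "x > 0" and \<gamma>: "\<gamma> = (1 / sqrt x) *\<^sub>R \<Psi>"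
      using fibre by (simp_all add: mem_observation_fibre_iff)
    have t_eq: "t = x * B x / 2"
      using t v by (simp add: angular_eigenvalue_iff)
    moreover have "r - t = A * (norm \<Psi>)\<^sup>2 / (2 * \<alpha> * x)"
      using r t_eq assms(4) by (simp add: radial_eigenvalue_iff)
    moreover have "x = A * (norm \<Psi>)\<^sup>2 / (2 * \<alpha> * (r - t))"
      by (rule texture_eq_of_eigenvalues[OF assms(1,2,4) x v r t])
    moreover have "B x = 2 * t / x"
      using t_eq x by (simp add: field_simps)
    ultimately show "t = x * B x / 2
            \<and> r - t = A * (norm \<Psi>)\<^sup>2 / (2 * \<alpha> * x)
            \<and> x = A * (norm \<Psi>)\<^sup>2 / (2 * \<alpha> * (r - t))
            \<and> \<gamma> = (1 / sqrt x) *\<^sub>R \<Psi>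
            \<and> B x = 2 * t / x"
      using \<gamma> by blast
  qed
next
  show "\<forall>B\<^sub>1 B\<^sub>2 x\<^sub>1 x\<^sub>2 \<gamma>\<^sub>1 \<gamma>\<^sub>2.
          (\<forall>x>0. B\<^sub>1 x > 0) \<and> (\<forall>x>0. B\<^sub>2 x > 0)
          \<and> (x\<^sub>1, \<gamma>\<^sub>1) \<in> observation_fibre \<Psi> \<and> (x\<^sub>2, \<gamma>\<^sub>2) \<in> observation_fibre \<Psi>
          \<and> local_covariance A \<alpha> B\<^sub>1 x\<^sub>1 \<Psi> = local_covariance A \<alpha> B\<^sub>2 x\<^sub>2 \<Psi> \<longrightarrow>
            x\<^sub>1 = x\<^sub>2 \<and> \<gamma>\<^sub>1 = \<gamma>\<^sub>2 \<and> B\<^sub>1 x\<^sub>1 = B\<^sub>2 x\<^sub>2"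
    using local_covariance_identifies[OF assms(1,2,4)]
    by (metis mem_observation_fibre_iff)
qed

end
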